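(* Let $\varphi$ be an expression such that $\mathcal{M}(\varphi)=\mathcal{B}(\varphi)$ (up to reordering). Then for every expression $\psi$ that is $\mathrm{B}_2$-equivalent to $\varphi$ (i.e. $\llbracket\varphi\rrbracket_u=\llbracket\psi\rrbracket_u$ for every binary valuation $u$) and for every valuation $v$ in $\mathrm{M}$, $|\llbracket\varphi\rrbracket_v|\ge|\llbracket\psi\rrbracket_v|$.
   Context: $\mathrm{M}$ denotes $\widehat{\mathbb{Z}}=(\mathbb{Z}\setminus\{0\})\cup\{-\infty,\infty\}$ with $\land=\min$, $\lor=\max$, $\lnot a=-a$ and $|\pm\infty|=\infty$. Expressions are propositional formulas over variables $x_1,\ldots,x_n$ built with $\land,\lor,\lnot$ (no constants); $\llbracket\varphi\rrbracket_v$ is the value under a valuation $v$. A literal is $x$ or $\bar x$; a term is a conjunction of literals, identified with its set of literals; a subterm is a term with a subset of the literals. An implicant of $\varphi$ is a term $\gamma$ such that every binary valuation making $\gamma$ true makes $\varphi$ true; it is prime if no proper subterm of it is an implicant. The Blake Canonical Form $\mathcal{B}(\varphi)$ is the disjunction of all prime implicants of $\varphi$. The De Morgan Canonical Form $\mathcal{M}(\varphi)$ is the unique (up to reordering) expression obtained from $\varphi$ using only the laws of De Morgan algebras (commutativity, associativity, idempotence, absorption, distributivity, double negation, De Morgan laws) which is in disjunctive normal form, in which no term contains the same literal twice, and no term is a subterm of another (contradictory terms such as $x\bar x$ are not removed).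
   Formalization: The Blake Canonical Form is taken as the disjunction of all non-contradictory prime implicants; if contradictory terms counted as implicants, the claim would fail, e.g. for φ = x ∨ (y ∧ ȳ), ψ = x at x = −5, y = 1. *)

theory Defs
  imports Main "HOL-Library.Extended_Real"
begin

datatype 'n expr =
    Var 'n
  | Neg "'n expr"
  | Conj "'n expr" "'n expr"
  | Disj "'n expr" "'n expr"

text \<open>
  The value algebra is \<^typ>\<open>bool\<close> (the two-element algebra, where the operations are conjunction,
  disjunction and negation) or the linearly ordered \<^typ>\<open>ereal\<close> (where they are minimum, maximum
  and \<open>a \<mapsto> - a\<close>).
\<close>

primrec eval :: "('n \<Rightarrow> 'a :: {lattice, uminus}) \<Rightarrow> 'n expr \<Rightarrow> 'a" where
  "eval v (Var x) = v x"
| "eval v (Neg \<phi>) = - eval v \<phi>"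
| "eval v (Conj \<phi> \<psi>) = inf (eval v \<phi>) (eval v \<psi>)"
| "eval v (Disj \<phi> \<psi>) = sup (eval v \<phi>) (eval v \<psi>)"

definition Zhat :: "ereal set" where
  "Zhat = {ereal (of_int k) | k. k \<noteq> 0} \<union> {-\<infinity>, \<infinity>}"

lemma eval_Zhat:
  assumes "\<And>x. v x \<in> Zhat"
  shows "eval v \<phi> \<in> Zhat"
proof (induction \<phi>)
  case (Neg \<phi>)
  have "- a \<in> Zhat" if "a \<in> Zhat" for a
  proof -
    have "- a \<in> Zhat" if "a = ereal (of_int k)" "k \<noteq> 0" for k
    proof -
      have "- a = ereal (of_int (- k))" "- k \<noteq> 0" using that by simp_all
      then show ?thesis unfolding Zhat_def by blast
    qed
    then show ?thesis using that unfolding Zhat_def by auto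
  qed
  with Neg show ?case by simp
qed (use assms in \<open>auto simp: inf_min sup_max min_def max_def\<close>)


subsection \<open>Implicants and the Blake canonical form\<close>

datatype 'n literal = PosL 'n | NegL 'n

primrec lit_expr :: "'n literal \<Rightarrow> 'n expr" where
  "lit_expr (PosL x) = Var x"
| "lit_expr (NegL x) = Neg (Var x)"

definition implicant :: "'n expr \<Rightarrow> 'n literal set \<Rightarrow> bool" where
  "implicant \<phi> \<gamma> \<longleftrightarrow>
    (\<forall>u :: 'n \<Rightarrow> bool. (\<forall>l\<in>\<gamma>. eval u (lit_expr l)) \<longrightarrow> eval u \<phi>)"

definition prime_implicant :: "'n expr \<Rightarrow> 'n literal set \<Rightarrow> bool" where
  "prime_implicant \<phi> \<gamma> \<longleftrightarrow> implicant \<phi> \<gamma> \<and> (\<forall>\<delta>. \<delta> \<subset> \<gamma> \<longrightarrow> \<not> implicant \<phi> \<delta>)"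

definition contradictory :: "'n literal set \<Rightarrow> bool" where
  "contradictory \<gamma> \<longleftrightarrow> (\<exists>x. PosL x \<in> \<gamma> \<and> NegL x \<in> \<gamma>)"

text \<open>
  Disjunctive normal forms up to reordering are represented by their sets of terms.
  As usual for the Blake canonical form, contradictory terms are not counted among the prime
  implicants; being vacuously implicants, they would otherwise appear in it (for example the
  form of \<open>x\<close> would be \<open>x \<or> (y \<and> \<not>y)\<close> as soon as there is a second variable \<open>y\<close>).
\<close>

definition blake :: "'n expr \<Rightarrow> 'n literal set set" where
  "blake \<phi> = {\<gamma>. prime_implicant \<phi> \<gamma> \<and> \<not> contradictory \<gamma>}"


subsection \<open>The De Morgan canonical form\<close>

inductive dm_eq :: "'n expr \<Rightarrow> 'n expr \<Rightarrow> bool" (infix "\<approx>" 50) where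
  refl: "a \<approx> a"
| sym: "a \<approx> b \<Longrightarrow> b \<approx> a"
| trans: "a \<approx> b \<Longrightarrow> b \<approx> c \<Longrightarrow> a \<approx> c"
| cong_neg: "a \<approx> b \<Longrightarrow> Neg a \<approx> Neg b"
| cong_conj: "a \<approx> a' \<Longrightarrow> b \<approx> b' \<Longrightarrow> Conj a b \<approx> Conj a' b'"
| cong_disj: "a \<approx> a' \<Longrightarrow> b \<approx> b' \<Longrightarrow> Disj a b \<approx> Disj a' b'"
| comm_conj: "Conj a b \<approx> Conj b a"
| comm_disj: "Disj a b \<approx> Disj b a"
| assoc_conj: "Conj (Conj a b) c \<approx> Conj a (Conj b c)"
| assoc_disj: "Disj (Disj a b) c \<approx> Disj a (Disj b c)"
| idem_conj: "Conj a a \<approx> a"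
| idem_disj: "Disj a a \<approx> a"
| absorb_conj: "Conj a (Disj a b) \<approx> a"
| absorb_disj: "Disj a (Conj a b) \<approx> a"
| distrib_conj: "Conj a (Disj b c) \<approx> Disj (Conj a b) (Conj a c)"
| distrib_disj: "Disj a (Conj b c) \<approx> Conj (Disj a b) (Disj a c)"
| double_neg: "Neg (Neg a) \<approx> a"
| de_morgan_conj: "Neg (Conj a b) \<approx> Disj (Neg a) (Neg b)"
| de_morgan_disj: "Neg (Disj a b) \<approx> Conj (Neg a) (Neg b)"

inductive term_of :: "'n expr \<Rightarrow> 'n literal list \<Rightarrow> bool" where
  lit: "term_of (lit_expr l) [l]"
| conj: "term_of a ls \<Longrightarrow> term_of b ms \<Longrightarrow> term_of (Conj a b) (ls @ ms)"

inductive dnf_of :: "'n expr \<Rightarrow> 'n literal list list \<Rightarrow> bool" where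
  "term": "term_of a ls \<Longrightarrow> dnf_of a [ls]"
| disj: "dnf_of a ts \<Longrightarrow> dnf_of b us \<Longrightarrow> dnf_of (Disj a b) (ts @ us)"

definition reduced :: "'n literal list list \<Rightarrow> bool" where
  "reduced ts \<longleftrightarrow> (\<forall>t\<in>set ts. distinct t) \<and>
    (\<forall>i<length ts. \<forall>j<length ts. i \<noteq> j \<longrightarrow> \<not> set (ts ! i) \<subseteq> set (ts ! j))"

definition is_dm_canonical :: "'n expr \<Rightarrow> 'n literal set set \<Rightarrow> bool" where
  "is_dm_canonical \<phi> T \<longleftrightarrow>
    (\<exists>\<chi> ts. \<phi> \<approx> \<chi> \<and> dnf_of \<chi> ts \<and> reduced ts \<and> T = set ` set ts)"

definition dm_canonical :: "'n expr \<Rightarrow> 'n literal set set" where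
  "dm_canonical \<phi> = (THE T. is_dm_canonical \<phi> T)"


subsection \<open>Existence and uniqueness of the De Morgan canonical form\<close>

text \<open>
  Uniqueness: evaluate with the two literals of each variable as independent Booleans.
\<close>

primrec lit_eval :: "('n literal \<Rightarrow> bool) \<Rightarrow> bool \<Rightarrow> 'n expr \<Rightarrow> bool" where
  "lit_eval w s (Var x) = w (if s then PosL x else NegL x)"
| "lit_eval w s (Neg a) = lit_eval w (\<not> s) a"
| "lit_eval w s (Conj a b) =
    (if s then lit_eval w s a \<and> lit_eval w s b else lit_eval w s a \<or> lit_eval w s b)"
| "lit_eval w s (Disj a b) =
    (if s then lit_eval w s a \<or> lit_eval w s b else lit_eval w s a \<and> lit_eval w s b)"

lemma dm_eq_lit_eval: "a \<approx> b \<Longrightarrow> lit_eval w s a = lit_eval w s b"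
  by (induction arbitrary: s rule: dm_eq.induct) auto

lemma term_of_lit_eval: "term_of a ls \<Longrightarrow> lit_eval w True a \<longleftrightarrow> (\<forall>l\<in>set ls. w l)"
proof (induction rule: term_of.induct)
  case (lit l)
  then show ?case by (cases l) auto
qed auto

lemma dnf_of_lit_eval:
  "dnf_of a ts \<Longrightarrow> lit_eval w True a \<longleftrightarrow> (\<exists>t\<in>set ts. \<forall>l\<in>set t. w l)"
  by (induction rule: dnf_of.induct) (auto simp: term_of_lit_eval)

lemma reduced_antichain:
  assumes "reduced ts" "A \<in> set ` set ts" "B \<in> set ` set ts" "A \<subseteq> B"
  shows "A = B"
proof -
  obtain i j where "i < length ts" "A = set (ts ! i)" "j < length ts" "B = set (ts ! j)"
    using assms(2,3) by (auto simp: in_set_conv_nth)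
  then show ?thesis using assms(1,4) unfolding reduced_def by (cases "i = j") auto
qed

lemma is_dm_canonical_subset:
  assumes "is_dm_canonical \<phi> T" "is_dm_canonical \<phi> U"
  shows "T \<subseteq> U"
proof
  fix A assume "A \<in> T"
  obtain \<chi> ts where t: "\<phi> \<approx> \<chi>" "dnf_of \<chi> ts" "reduced ts" "T = set ` set ts"
    using assms(1) unfolding is_dm_canonical_def by blast
  obtain \<xi> us where u: "\<phi> \<approx> \<xi>" "dnf_of \<xi> us" "reduced us" "U = set ` set us"
    using assms(2) unfolding is_dm_canonical_def by blast
  have eq: "(\<exists>B\<in>T. B \<subseteq> W) \<longleftrightarrow> (\<exists>B\<in>U. B \<subseteq> W)" for W
  proof -
    have "lit_eval (\<lambda>l. l \<in> W) True \<chi> = lit_eval (\<lambda>l. l \<in> W) True \<xi>"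
      using dm_eq_lit_eval[OF t(1)] dm_eq_lit_eval[OF u(1)] by blast
    then show ?thesis
      unfolding dnf_of_lit_eval[OF t(2)] dnf_of_lit_eval[OF u(2)] t(4) u(4) by (simp add: subset_eq)
  qed
  obtain B where B: "B \<in> U" "B \<subseteq> A" using eq[of A] \<open>A \<in> T\<close> by blast
  obtain C where C: "C \<in> T" "C \<subseteq> B" using eq[of B] B(1) by blast
  have "C = A"
    using reduced_antichain[OF t(3)] C B \<open>A \<in> T\<close> unfolding t(4) by blast
  with B C have "A = B" by blast
  then show "A \<in> U" using B by simp
qed

lemma conj_absorb_left: "Conj x a \<approx> a \<Longrightarrow> Conj x (Conj a b) \<approx> Conj a b"
  by (rule dm_eq.trans[OF dm_eq.sym[OF dm_eq.assoc_conj] dm_eq.cong_conj[OF _ dm_eq.refl]])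

lemma conj_absorb_right: "Conj x b \<approx> b \<Longrightarrow> Conj x (Conj a b) \<approx> Conj a b"
  by (rule dm_eq.trans[OF dm_eq.cong_conj[OF dm_eq.refl dm_eq.comm_conj]
        dm_eq.trans[OF conj_absorb_left dm_eq.comm_conj]])

lemma conj_absorb_both: "Conj a c \<approx> c \<Longrightarrow> Conj b c \<approx> c \<Longrightarrow> Conj (Conj a b) c \<approx> c"
  by (rule dm_eq.trans[OF dm_eq.assoc_conj dm_eq.trans[OF dm_eq.cong_conj[OF dm_eq.refl]]])

lemma disj_absorb_left: "Disj x a \<approx> a \<Longrightarrow> Disj x (Disj a b) \<approx> Disj a b"
  by (rule dm_eq.trans[OF dm_eq.sym[OF dm_eq.assoc_disj] dm_eq.cong_disj[OF _ dm_eq.refl]])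

lemma disj_absorb_right: "Disj x b \<approx> b \<Longrightarrow> Disj x (Disj a b) \<approx> Disj a b"
  by (rule dm_eq.trans[OF dm_eq.cong_disj[OF dm_eq.refl dm_eq.comm_disj]
        dm_eq.trans[OF disj_absorb_left dm_eq.comm_disj]])

lemma disj_absorb_both: "Disj a c \<approx> c \<Longrightarrow> Disj b c \<approx> c \<Longrightarrow> Disj (Disj a b) c \<approx> c"
  by (rule dm_eq.trans[OF dm_eq.assoc_disj dm_eq.trans[OF dm_eq.cong_disj[OF dm_eq.refl]]])

lemma lit_conj_absorb: "term_of a ls \<Longrightarrow> l \<in> set ls \<Longrightarrow> Conj (lit_expr l) a \<approx> a"
proof (induction rule: term_of.induct)
  case (lit m)
  then show ?case by (auto intro: dm_eq.idem_conj)
next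
  case (conj a ls b ms)
  show ?case
  proof (cases "l \<in> set ls")
    case True
    then have "Conj (lit_expr l) a \<approx> a" using conj by blast
    then show ?thesis by (rule conj_absorb_left)
  next
    case False
    then have "Conj (lit_expr l) b \<approx> b" using conj by simp
    then show ?thesis by (rule conj_absorb_right)
  qed
qed

lemma term_conj_absorb:
  "term_of b ms \<Longrightarrow> term_of a ls \<Longrightarrow> set ms \<subseteq> set ls \<Longrightarrow> Conj b a \<approx> a"
proof (induction rule: term_of.induct)
  case (lit m)
  then show ?case by (auto intro: lit_conj_absorb)
next
  case (conj b ms b' ms')
  then have "Conj b a \<approx> a" "Conj b' a \<approx> a" by auto
  then show ?case by (rule conj_absorb_both)
qed

lemma term_disj_absorb:
  assumes "term_of b ms" "term_of a ls" "set ms \<subseteq> set ls"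
  shows "Disj a b \<approx> b"
proof -
  have "Disj b a \<approx> Disj b (Conj b a)"
    by (rule dm_eq.cong_disj[OF dm_eq.refl dm_eq.sym[OF term_conj_absorb[OF assms]]])
  then have "Disj b a \<approx> b" by (rule dm_eq.trans[OF _ dm_eq.absorb_disj])
  then show ?thesis by (rule dm_eq.trans[OF dm_eq.comm_disj])
qed

lemma dnf_disj_absorb1:
  "dnf_of \<chi> ts \<Longrightarrow> t \<in> set ts \<Longrightarrow> term_of a ls \<Longrightarrow> set t \<subseteq> set ls \<Longrightarrow> Disj a \<chi> \<approx> \<chi>"
proof (induction rule: dnf_of.induct)
  case ("term" b ms)
  then show ?case by (auto intro: term_disj_absorb)
next
  case (disj b ts c us)
  show ?case
  proof (cases "t \<in> set ts")
    case True
    then have "Disj a b \<approx> b" using disj by blast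
    then show ?thesis by (rule disj_absorb_left)
  next
    case False
    then have "Disj a c \<approx> c" using disj by simp
    then show ?thesis by (rule disj_absorb_right)
  qed
qed

lemma dnf_disj_absorb:
  "dnf_of \<xi> us \<Longrightarrow> dnf_of \<chi> ts \<Longrightarrow> \<forall>u\<in>set us. \<exists>t\<in>set ts. set t \<subseteq> set u \<Longrightarrow> Disj \<xi> \<chi> \<approx> \<chi>"
proof (induction rule: dnf_of.induct)
  case ("term" b ms)
  then show ?case by (auto intro: dnf_disj_absorb1)
next
  case (disj b us c us')
  then have "Disj b \<chi> \<approx> \<chi>" "Disj c \<chi> \<approx> \<chi>" by auto
  then show ?case by (rule disj_absorb_both)
qed

lemma dnf_eq:
  assumes "dnf_of \<xi> us" "dnf_of \<chi> ts"
    and "\<forall>u\<in>set us. \<exists>t\<in>set ts. set t \<subseteq> set u" "\<forall>t\<in>set ts. \<exists>u\<in>set us. set u \<subseteq> set t"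
  shows "\<xi> \<approx> \<chi>"
  by (rule dm_eq.trans[OF dm_eq.sym[OF dnf_disj_absorb[OF assms(2,1,4)]]
        dm_eq.trans[OF dm_eq.comm_disj dnf_disj_absorb[OF assms(1,2,3)]]])

lemma ex_term_of: "ls \<noteq> [] \<Longrightarrow> \<exists>a. term_of a ls"
proof (induction ls rule: list_nonempty_induct)
  case (single x)
  then show ?case using term_of.lit by blast
next
  case (cons x xs)
  then show ?case using term_of.conj[OF term_of.lit[of x]] by fastforce
qed

lemma ex_dnf_of: "ts \<noteq> [] \<Longrightarrow> \<forall>t\<in>set ts. t \<noteq> [] \<Longrightarrow> \<exists>a. dnf_of a ts"
proof (induction ts rule: list_nonempty_induct)
  case (single x)
  then obtain b where "term_of b x" using ex_term_of[of x] by auto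
  then show ?case using dnf_of.term by blast
next
  case (cons x xs)
  then obtain a b where "dnf_of a xs" "term_of b x" using ex_term_of[of x] by auto
  then have "dnf_of (Disj b a) ([x] @ xs)" by (intro dnf_of.intros)
  then show ?case by auto
qed

lemma term_of_nonempty: "term_of a ls \<Longrightarrow> ls \<noteq> []"
  by (induction rule: term_of.induct) auto

lemma dnf_of_nonempty: "dnf_of a ts \<Longrightarrow> ts \<noteq> [] \<and> (\<forall>t\<in>set ts. t \<noteq> [])"
  by (induction rule: dnf_of.induct) (auto simp: term_of_nonempty)

definition has_dnf :: "'n expr \<Rightarrow> bool" where
  "has_dnf a \<longleftrightarrow> (\<exists>\<chi> ts. a \<approx> \<chi> \<and> dnf_of \<chi> ts)"

lemma has_dnf_eq: "a \<approx> b \<Longrightarrow> has_dnf b \<Longrightarrow> has_dnf a"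
  unfolding has_dnf_def by (meson dm_eq.trans)

lemma has_dnf_disj: "has_dnf a \<Longrightarrow> has_dnf b \<Longrightarrow> has_dnf (Disj a b)"
  unfolding has_dnf_def by (meson dm_eq.cong_disj dnf_of.disj)

lemma has_dnf_conj_term: "dnf_of b us \<Longrightarrow> term_of a ls \<Longrightarrow> has_dnf (Conj a b)"
proof (induction rule: dnf_of.induct)
  case ("term" b ms)
  then show ?case unfolding has_dnf_def by (meson dm_eq.refl dnf_of.term term_of.conj)
next
  case (disj b ts c us)
  then show ?case using has_dnf_eq[OF dm_eq.distrib_conj] has_dnf_disj by blast
qed

lemma has_dnf_conj_dnf: "dnf_of a ts \<Longrightarrow> dnf_of b us \<Longrightarrow> has_dnf (Conj a b)"
proof (induction rule: dnf_of.induct)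
  case ("term" a ls)
  then show ?case by (auto intro: has_dnf_conj_term)
next
  case (disj a ts c us)
  then have "has_dnf (Disj (Conj b a) (Conj b c))"
    using has_dnf_disj has_dnf_eq[OF dm_eq.comm_conj] by blast
  then show ?case by (rule has_dnf_eq[OF dm_eq.trans[OF dm_eq.comm_conj dm_eq.distrib_conj]])
qed

lemma has_dnf_conj: "has_dnf a \<Longrightarrow> has_dnf b \<Longrightarrow> has_dnf (Conj a b)"
  using has_dnf_conj_dnf has_dnf_eq[OF dm_eq.cong_conj] unfolding has_dnf_def[of a] has_dnf_def[of b]
  by blast

lemma has_dnf_lit: "has_dnf (lit_expr l)"
  unfolding has_dnf_def by (meson dm_eq.refl dnf_of.term term_of.lit)

lemma has_dnf: "has_dnf a \<and> has_dnf (Neg a)"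
proof (induction a)
  case (Var x)
  then show ?case using has_dnf_lit[of "PosL x"] has_dnf_lit[of "NegL x"] by simp
next
  case (Neg a)
  then show ?case using has_dnf_eq[OF dm_eq.double_neg] by blast
next
  case (Conj a b)
  then show ?case using has_dnf_eq[OF dm_eq.de_morgan_conj] has_dnf_conj has_dnf_disj by blast
next
  case (Disj a b)
  then show ?case using has_dnf_eq[OF dm_eq.de_morgan_disj] has_dnf_conj has_dnf_disj by blast
qed

lemma ex_is_dm_canonical: "\<exists>T. is_dm_canonical \<phi> T"
proof -
  obtain \<chi> ts where t: "\<phi> \<approx> \<chi>" "dnf_of \<chi> ts" using has_dnf unfolding has_dnf_def by blast
  define S where "S = set ` set ts"
  define T where "T = {A \<in> S. \<forall>B\<in>S. B \<subseteq> A \<longrightarrow> B = A}"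
  have fin: "finite S" "finite T" unfolding S_def T_def by auto
  have min: "\<exists>B\<in>T. B \<subseteq> A" if "A \<in> S" for A
    using finite_has_minimal2[OF fin(1) that] unfolding T_def by blast
  have finA: "finite A" "A \<noteq> {}" if "A \<in> T" for A
    using that dnf_of_nonempty[OF t(2)] unfolding T_def S_def by auto
  obtain As where As: "set As = T" "distinct As" using finite_distinct_list[OF fin(2)] by blast
  obtain f where f: "\<And>A. A \<in> T \<Longrightarrow> set (f A) = A \<and> distinct (f A)"
    using finite_distinct_list finA(1) by metis
  define us where "us = map f As"
  have nth: "set (us ! i) = As ! i" "As ! i \<in> T" if "i < length us" for i
    using that As(1) f unfolding us_def by (auto simp: nth_mem)
  have im: "set ` set us = T" using f As(1) unfolding us_def by (force simp: image_image)
  have "T \<noteq> {}" using min dnf_of_nonempty[OF t(2)] unfolding S_def by fastforce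
  then have "us \<noteq> []" "\<forall>u\<in>set us. u \<noteq> []" using im finA(2) by fastforce+
  then obtain \<xi> where \<xi>: "dnf_of \<xi> us" using ex_dnf_of by blast
  have red: "reduced us"
    unfolding reduced_def
  proof (intro conjI allI impI ballI)
    show "distinct u" if "u \<in> set us" for u using that f As(1) unfolding us_def by auto
    fix i j assume ij: "i < length us" "j < length us" "i \<noteq> j"
    then have "As ! i \<noteq> As ! j" using As(2) unfolding us_def by (simp add: nth_eq_iff_index_eq)
    then show "\<not> set (us ! i) \<subseteq> set (us ! j)"
      using nth[OF ij(1)] nth[OF ij(2)] unfolding T_def by auto
  qed
  have "\<chi> \<approx> \<xi>"
  proof (rule dnf_eq[OF t(2) \<xi>])
    show "\<forall>u\<in>set ts. \<exists>t\<in>set us. set t \<subseteq> set u"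
      using min unfolding im[symmetric] S_def by blast
    show "\<forall>t\<in>set us. \<exists>u\<in>set ts. set u \<subseteq> set t"
    proof
      fix t assume "t \<in> set us"
      then have "set t \<in> S" using im unfolding T_def by blast
      then show "\<exists>u\<in>set ts. set u \<subseteq> set t" unfolding S_def by auto
    qed
  qed
  then have "\<phi> \<approx> \<xi>" by (rule dm_eq.trans[OF t(1)])
  then show ?thesis unfolding is_dm_canonical_def using \<xi> red by blast
qed

lemma ex1_is_dm_canonical: "\<exists>!T. is_dm_canonical \<phi> T"
  using ex_is_dm_canonical is_dm_canonical_subset by (metis subset_antisym)

lemma is_dm_canonical_dm_canonical: "is_dm_canonical \<phi> (dm_canonical \<phi>)"
  unfolding dm_canonical_def by (rule theI'[OF ex1_is_dm_canonical])

end

theory Submission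
  imports Defs
begin

text \<open>
  Put \<open>a = \<bar>eval v \<psi>\<bar> > 0\<close> and let \<open>\<gamma>\<close> be the term of all literals of value at least \<open>a\<close>. Replacing
  values of modulus less than \<open>a\<close> by arbitrary truth values does not affect the truth value of \<open>\<psi>\<close>,
  so \<open>\<gamma>\<close> forces the value of \<open>\<psi>\<close>, hence of \<open>\<phi>\<close>. If \<open>eval v \<psi> = a\<close>, then \<open>\<gamma>\<close> is an implicant of
  \<open>\<phi>\<close> and contains a prime one; this is a disjunct of \<open>\<phi>\<close> of value at least \<open>a\<close>. If
  \<open>eval v \<psi> = - a\<close>, then every prime implicant of \<open>\<phi>\<close> is inconsistent with \<open>\<gamma>\<close>, so that every
  disjunct of \<open>\<phi>\<close> has value at most \<open>- a\<close>.
\<close>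

text \<open>On a chain, an up-closed \<open>P\<close> holds of a minimum iff of both arguments and
  of a maximum iff of one. The flag \<open>s\<close> pushes negations down to the literals, so
  \<open>P\<close> need not respect negation.\<close>

lemma lit_eval_upclosed:
  fixes v :: "'n \<Rightarrow> ereal"
  assumes up: "\<And>y z. P y \<Longrightarrow> y \<le> z \<Longrightarrow> P z"
  shows "lit_eval (\<lambda>l. P (eval v (lit_expr l))) s \<phi> \<longleftrightarrow> P (if s then eval v \<phi> else - eval v \<phi>)"
proof -
  have P_min: "P (min y z) \<longleftrightarrow> P y \<and> P z" for y z
    using up by (metis min.cobounded1 min.cobounded2 min_def)
  have P_max: "P (max y z) \<longleftrightarrow> P y \<or> P z" for y z
    using up by (metis max.cobounded1 max.cobounded2 max_def)
  have neg_min: "- min y z = max (- y) (- z)" and neg_max: "- max y z = min (- y) (- z)"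
    for y z :: ereal
    by (auto simp: min_def max_def)
  show ?thesis
    by (induction \<phi> arbitrary: s)
      (auto simp: P_min P_max neg_min neg_max inf_min sup_max)
qed

text \<open>\<open>lit_eval\<close> is invariant under the De Morgan laws, so \<phi> may be replaced
  by its canonical form. It serves for the thresholds \<open>a \<le> y\<close> and
  \<open>- a < y\<close>.\<close>

lemma eval_upclosed_dm_canonical:
  fixes v :: "'n \<Rightarrow> ereal"
  assumes "\<And>y z. P y \<Longrightarrow> y \<le> z \<Longrightarrow> P z"
  shows "P (eval v \<phi>) \<longleftrightarrow> (\<exists>\<gamma>\<in>dm_canonical \<phi>. \<forall>l\<in>\<gamma>. P (eval v (lit_expr l)))"
proof -
  obtain \<chi> ts where \<chi>: "\<phi> \<approx> \<chi>" "dnf_of \<chi> ts" "dm_canonical \<phi> = set ` set ts"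
    using is_dm_canonical_dm_canonical[of \<phi>] unfolding is_dm_canonical_def by blast
  have "P (eval v \<phi>) \<longleftrightarrow> lit_eval (\<lambda>l. P (eval v (lit_expr l))) True \<phi>"
    using lit_eval_upclosed[of P v True \<phi>] assms by auto
  also have "\<dots> \<longleftrightarrow> (\<exists>\<gamma>\<in>dm_canonical \<phi>. \<forall>l\<in>\<gamma>. P (eval v (lit_expr l)))"
    using dm_eq_lit_eval[OF \<chi>(1)] dnf_of_lit_eval[OF \<chi>(2)] \<chi>(3) by simp
  finally show ?thesis .
qed

lemma ereal_le_uminus_commute: "a \<le> - b \<longleftrightarrow> b \<le> - (a :: ereal)"
  using ereal_minus_le_minus[of "- b" a] by simp

text \<open>Values strictly between \<open>- a\<close> and \<open>a\<close> may be rounded either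
  way. Both bounds are proved together because \<open>Neg\<close> exchanges them.\<close>

lemma eval_threshold:
  fixes v :: "'n \<Rightarrow> ereal" and u :: "'n \<Rightarrow> bool"
  assumes "\<And>x. a \<le> v x \<Longrightarrow> u x" "\<And>x. v x \<le> - a \<Longrightarrow> \<not> u x"
  shows "(a \<le> eval v \<psi> \<longrightarrow> eval u \<psi>) \<and> (eval v \<psi> \<le> - a \<longrightarrow> \<not> eval u \<psi>)"
proof (induction \<psi>)
  case (Neg \<psi>)
  then show ?case using ereal_le_uminus_commute[of a "eval v \<psi>"] by auto
qed (use assms in \<open>auto simp: inf_min sup_max min_le_iff_disj le_max_iff_disj\<close>)

lemma implicant_contains_prime:
  assumes "implicant \<phi> \<gamma>" "finite \<gamma>"
  obtains \<delta> where "\<delta> \<subseteq> \<gamma>" "prime_implicant \<phi> \<delta>"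
proof -
  have "finite {\<delta>. \<delta> \<subseteq> \<gamma> \<and> implicant \<phi> \<delta>}" "\<gamma> \<in> {\<delta>. \<delta> \<subseteq> \<gamma> \<and> implicant \<phi> \<delta>}"
    using assms by auto
  then obtain \<delta> where "\<delta> \<subseteq> \<gamma>" "implicant \<phi> \<delta>"
    "\<forall>\<delta>'\<in>{\<delta>. \<delta> \<subseteq> \<gamma> \<and> implicant \<phi> \<delta>}. \<delta>' \<subseteq> \<delta> \<longrightarrow> \<delta> = \<delta>'"
    using finite_has_minimal2 by (smt (verit, best) mem_Collect_eq)
  then have "prime_implicant \<phi> \<delta>" unfolding prime_implicant_def by blast
  with \<open>\<delta> \<subseteq> \<gamma>\<close> show thesis by (rule that)
qed

theorem theorem3:
  fixes \<phi> \<psi> :: "'n::finite expr" and v :: "'n \<Rightarrow> ereal"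
  assumes "dm_canonical \<phi> = blake \<phi>"
    and "\<forall>u :: 'n \<Rightarrow> bool. eval u \<phi> = eval u \<psi>"
    and "\<forall>x. v x \<in> Zhat"
  shows "\<bar>eval v \<phi>\<bar> \<ge> \<bar>eval v \<psi>\<bar>"
proof (cases "eval v \<psi> = 0")
  case False
  define a where "a = \<bar>eval v \<psi>\<bar>"
  have "0 < a" using False unfolding a_def by (cases "eval v \<psi>") auto
  then have "- a < a" by (cases a) auto
  have "eval v \<psi> = a \<or> eval v \<psi> = - a"
    unfolding a_def by (cases "eval v \<psi>") (auto simp: abs_if)
  then consider (pos) "eval v \<psi> = a" | (neg) "eval v \<psi> = - a" by blast
  then have "a \<le> \<bar>eval v \<phi>\<bar>"
  proof cases
    case pos
    define \<gamma> where "\<gamma> = {l. a \<le> eval v (lit_expr l)}"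
    have "implicant \<phi> \<gamma>"
      unfolding implicant_def
    proof (intro allI impI)
      fix u :: "'n \<Rightarrow> bool"
      assume u: "\<forall>l\<in>\<gamma>. eval u (lit_expr l)"
      have "u x" if "a \<le> v x" for x
        using u[rule_format, of "PosL x"] that unfolding \<gamma>_def by simp
      moreover have "\<not> u x" if "v x \<le> - a" for x
        using u[rule_format, of "NegL x"] that ereal_le_uminus_commute[of a "v x"]
        unfolding \<gamma>_def by simp
      ultimately have "eval u \<psi>" using eval_threshold[of a v u \<psi>] pos by simp
      then show "eval u \<phi>" using assms(2) by blast
    qed
    moreover have "finite \<gamma>"
    proof (rule finite_subset)
      show "\<gamma> \<subseteq> range PosL \<union> range NegL"
      proof
        show "l \<in> range PosL \<union> range NegL" for l :: "'n literal" by (cases l) auto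
      qed
    qed simp
    ultimately obtain \<delta> where \<delta>: "\<delta> \<subseteq> \<gamma>" "prime_implicant \<phi> \<delta>"
      by (rule implicant_contains_prime)
    \<comment> \<open>\<open>blake\<close> keeps only consistent terms, so this is needed to place
      \<delta> among the disjuncts of \<phi>.\<close>
    have "\<not> contradictory \<delta>"
      unfolding contradictory_def
    proof
      assume "\<exists>x. PosL x \<in> \<delta> \<and> NegL x \<in> \<delta>"
      then obtain x where "PosL x \<in> \<gamma>" "NegL x \<in> \<gamma>" using \<delta>(1) by blast
      then have "a \<le> v x" "v x \<le> - a"
        using ereal_le_uminus_commute[of a "v x"] unfolding \<gamma>_def by simp_all
      then show False using \<open>- a < a\<close> by simp
    qed
    then have "\<delta> \<in> dm_canonical \<phi>" using \<delta>(2) assms(1) unfolding blake_def by simp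
    moreover have "\<forall>l\<in>\<delta>. a \<le> eval v (lit_expr l)"
      using \<delta>(1) unfolding \<gamma>_def by blast
    ultimately have "a \<le> eval v \<phi>"
      using eval_upclosed_dm_canonical[of "\<lambda>y. a \<le> y" v \<phi>] by (meson order_trans)
    then show ?thesis by (cases "eval v \<phi>") (cases a; auto)+
  next
    case neg
    \<comment> \<open>A strict lower bound is an up-closed condition, so its failure can be tested
      on the disjuncts.\<close>
    have "\<not> - a < eval v \<phi>"
    proof
      assume "- a < eval v \<phi>"
      then obtain \<delta> where \<delta>: "\<delta> \<in> dm_canonical \<phi>" "\<forall>l\<in>\<delta>. - a < eval v (lit_expr l)"
        using eval_upclosed_dm_canonical[of "\<lambda>y. - a < y" v \<phi>] by (meson less_le_trans)
      then have imp: "implicant \<phi> \<delta>" "\<not> contradictory \<delta>"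
        using assms(1) unfolding blake_def prime_implicant_def by auto
      \<comment> \<open>The valuation is chosen to satisfy \<delta> while respecting both
        thresholds, so that it makes \<psi> false and \<phi> true.\<close>
      define u where "u x \<longleftrightarrow> PosL x \<in> \<delta> \<or> a \<le> v x" for x
      have "\<not> u x" if "v x \<le> - a" for x
        using \<delta>(2) that \<open>- a < a\<close> unfolding u_def by fastforce
      then have "\<not> eval u \<psi>" using eval_threshold[of a v u \<psi>] neg unfolding u_def by simp
      moreover have "eval u (lit_expr l)" if "l \<in> \<delta>" for l
      proof (cases l)
        case (NegL x)
        \<comment> \<open>From \<open>- a < - v x\<close>; this excludes the second disjunct of
          \<open>u x\<close>, and consistency of \<delta> the first.\<close>
        have "v x < a" using \<delta>(2) that NegL by fastforce
        then show ?thesis using NegL that imp(2) unfolding u_def contradictory_def by auto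
      qed (use that in \<open>simp add: u_def\<close>)
      ultimately show False using imp(1) assms(2) unfolding implicant_def by blast
    qed
    then show ?thesis by (cases "eval v \<phi>") (cases a; auto)+
  qed
  then show ?thesis unfolding a_def .
qed simp

end
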